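(* Let $Q(t)$, $t\ge0$, be a solution of $\dot Q=F(Q)$ with $Q(0)\in O(n)$. Then for all $m=1,2,\dots,n$ and all $t>0$, $$\sigma_m(Q(t))=\sigma_m(Q(0)).$$
   Context: $A=\mathrm{diag}\{\lambda_1,\dots,\lambda_n\}\in\mathbb{R}^{n\times n}$ with $\lambda_1>\lambda_2>\dots>\lambda_n>0$. $O(n)=\{Q\in\mathbb{R}^{n\times n}: Q^TQ=I_n\}$. $E_j$ denotes the $n\times n$ matrix with entry $1$ at position $(j,j)$ and $0$ elsewhere, and $$F(Q)=Q\sum_{j=1}^n\sum_{k=1}^{j-1}\left(E_jQ^TAQE_k-E_kQ^TAQE_j\right).$$ $M[a_1,\dots,a_r;\,b_1,\dots,b_c]$ denotes the submatrix of $M$ formed from rows $a_1,\dots,a_r$ and columns $b_1,\dots,b_c$ (in the listed order). For an invertible $Q\in\mathbb{R}^{n\times n}$ with entries $q_{i,j}$ define recursively $$\sigma_1(Q)=\min\{1\le k\le n:\ q_{1,k}\ne0\},$$ $$\sigma_m(Q)=\min\{1\le k\le n:\ \det(Q[1,\dots,m;\ \sigma_1(Q),\dots,\sigma_{m-1}(Q),k])\neq0\},\quad 2\le m\le n.$$ *)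

theory Defs
  imports Complex_Main "Jordan_Normal_Form.Determinant"
begin

text \<open>
  Rows, columns and the values of \<open>sigma\<close> are numbered from 1, as is usual in linear algebra,
  whereas \<open>$$\<close> counts from 0; the definitions below make the shift explicit.
\<close>

definition entry :: "real mat \<Rightarrow> nat \<Rightarrow> nat \<Rightarrow> real" where
  "entry M i j = M $$ (i - 1, j - 1)"

definition diag_matrix :: "nat \<Rightarrow> (nat \<Rightarrow> real) \<Rightarrow> real mat" where
  "diag_matrix n d = mat_diag n (\<lambda>i. d (i + 1))"

definition orthogonal_group :: "nat \<Rightarrow> real mat set" where
  "orthogonal_group n = {Q \<in> carrier_mat n n. transpose_mat Q * Q = 1\<^sub>m n}"

definition unit_diag :: "nat \<Rightarrow> nat \<Rightarrow> real mat" where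
  "unit_diag n j = diag_matrix n (\<lambda>i. if i = j then 1 else 0)"

text \<open>
  The double sum is taken entrywise because \<open>mat\<close>, which carries its dimensions in its values,
  has no zero and hence no \<open>sum\<close>.
\<close>

definition flow_field :: "nat \<Rightarrow> real mat \<Rightarrow> real mat \<Rightarrow> real mat" where
  "flow_field n A Q = Q * mat n n (\<lambda>(r, c). \<Sum>j = 1..n. \<Sum>k = 1..<j.
     (unit_diag n j * transpose_mat Q * A * Q * unit_diag n k
      - unit_diag n k * transpose_mat Q * A * Q * unit_diag n j) $$ (r, c))"

text \<open>A solution on \<open>[0, \<infinity>)\<close>; the derivative at \<open>0\<close> is one-sided.\<close>

definition flow_solution :: "nat \<Rightarrow> real mat \<Rightarrow> (real \<Rightarrow> real mat) \<Rightarrow> bool" where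
  "flow_solution n A Q \<longleftrightarrow>
     (\<forall>t\<ge>0. Q t \<in> carrier_mat n n) \<and>
     (\<forall>t\<ge>0. \<forall>i<n. \<forall>j<n.
        ((\<lambda>s. Q s $$ (i, j)) has_real_derivative flow_field n A (Q t) $$ (i, j)) (at t within {0..}))"

definition select_submatrix :: "real mat \<Rightarrow> nat list \<Rightarrow> nat list \<Rightarrow> real mat" where
  "select_submatrix M as bs =
     mat (length as) (length bs) (\<lambda>(i, j). entry M (as ! i) (bs ! j))"

text \<open>
  Meaningful for invertible \<open>Q\<close> and \<open>1 \<le> m \<le> dim_col Q\<close>, when the sets below are nonempty;
  \<open>Min\<close> of an empty set is unspecified.
\<close>

fun sigma :: "real mat \<Rightarrow> nat \<Rightarrow> nat" where
  "sigma Q m =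
     (if m \<le> 1 then Min {k \<in> {1..dim_col Q}. entry Q 1 k \<noteq> 0}
      else Min {k \<in> {1..dim_col Q}.
             det (select_submatrix Q [1..<m + 1] (map (sigma Q) [1..<m] @ [k])) \<noteq> 0})"

declare sigma.simps [simp del]

end

theory Submission
  imports Defs
begin

text \<open>
  The pivot \<open>sigma Q m\<close> is the furthest column that can be the leading column of a combination of
  rows \<open>1, ..., m\<close> in which row \<open>m\<close> occurs. This description is unchanged when the rows are scaled,
  and along the flow the rows of \<open>exp (-t * A) * Q t\<close> satisfy a linear equation with an upper
  triangular coefficient matrix, so that an initial segment of zeros of a combination persists
  forwards and backwards in time.
\<close>

section \<open>Greedy pivots and leading entries of row combinations\<close>

text \<open>For \<open>m = 1\<close> the list of earlier pivots is empty and the minor is the single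
  entry in row 1, so both branches of \<open>sigma\<close> become one formula.\<close>

definition pivot_minor :: "real mat \<Rightarrow> nat \<Rightarrow> nat \<Rightarrow> real" where
  "pivot_minor Q m k =
     det (select_submatrix Q [1..<m + 1] (map (sigma Q) [1..<m] @ [k]))"

definition row_comb :: "real mat \<Rightarrow> nat \<Rightarrow> (nat \<Rightarrow> real) \<Rightarrow> nat \<Rightarrow> real" where
  "row_comb Q m v k = (\<Sum>i = 1..m. v i * entry Q i k)"

text \<open>No upper bound on \<open>p\<close> is built in. For invertible \<open>Q\<close> it
  follows: a combination vanishing in all columns of \<open>Q\<close> has only zero coefficients,
  hence has no leading column at all.\<close>

definition leading_column :: "real mat \<Rightarrow> nat \<Rightarrow> (nat \<Rightarrow> real) \<Rightarrow> nat \<Rightarrow> bool" where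
  "leading_column Q m v p \<longleftrightarrow>
     1 \<le> p \<and> row_comb Q m v p \<noteq> 0 \<and> (\<forall>k\<in>{1..<p}. row_comb Q m v k = 0)"

lemma row_comb_Suc:
  "row_comb Q (Suc m) v k = row_comb Q m v k + v (Suc m) * entry Q (Suc m) k"
  by (simp add: row_comb_def)

lemma row_comb_diff_scaled:
  "row_comb Q m (\<lambda>i. v i - c * w i) k = row_comb Q m v k - c * row_comb Q m w k"
  by (simp add: row_comb_def algebra_simps sum_subtractf sum_distrib_left)

section \<open>Pivot minors as row combinations\<close>

lemma select_submatrix_carrier:
  "length as = r \<Longrightarrow> length bs = c \<Longrightarrow> select_submatrix Q as bs \<in> carrier_mat r c"
  by (simp add: select_submatrix_def)

lemma det_select_append_column:
  assumes len: "length as = Suc (length bs)"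
  obtains c where
    "\<And>k. det (select_submatrix Q as (bs @ [k])) = (\<Sum>i<Suc (length bs). c i * entry Q (as ! i) k)"
    "c (length bs) = det (select_submatrix Q (butlast as) bs)"
proof
  let ?r = "length bs"
  \<comment> \<open>The column index 0 is a placeholder: these cofactors delete the last column and
    never read it.\<close>
  define c where "c i = cofactor (select_submatrix Q as (bs @ [0])) i ?r" for i
  have delete_indep: "mat_delete (select_submatrix Q as (bs @ [k])) i ?r
      = mat_delete (select_submatrix Q as (bs @ [0])) i ?r" for k i
    using len by (intro eq_matI) (auto simp: mat_delete_def select_submatrix_def nth_append)
  have cofactor_indep: "cofactor (select_submatrix Q as (bs @ [k])) i ?r = c i" for k i
    by (simp add: c_def cofactor_def delete_indep[of k])
  show "det (select_submatrix Q as (bs @ [k])) = (\<Sum>i<Suc ?r. c i * entry Q (as ! i) k)" for k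
  proof -
    have "select_submatrix Q as (bs @ [k]) \<in> carrier_mat (Suc ?r) (Suc ?r)"
      using len by (intro select_submatrix_carrier) auto
    then have "det (select_submatrix Q as (bs @ [k]))
        = (\<Sum>i<Suc ?r. select_submatrix Q as (bs @ [k]) $$ (i, ?r) * c i)"
      by (subst laplace_expansion_column[of _ "Suc ?r" ?r]) (simp_all only: cofactor_indep lessI)
    also have "\<dots> = (\<Sum>i<Suc ?r. c i * entry Q (as ! i) k)"
      using len by (intro sum.cong) (auto simp: select_submatrix_def)
    finally show ?thesis .
  qed
  have "mat_delete (select_submatrix Q as (bs @ [0])) ?r ?r = select_submatrix Q (butlast as) bs"
    using len by (intro eq_matI)
      (auto simp: mat_delete_def select_submatrix_def nth_append nth_butlast)
  then show "c ?r = det (select_submatrix Q (butlast as) bs)"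
    by (simp add: c_def cofactor_def flip: mult_2)
qed

text \<open>The coefficients are the cofactors of the last column, which do not depend on that column.\<close>

lemma pivot_minor_eq_row_comb:
  obtains w where
    "\<And>k. pivot_minor Q (Suc m) k = row_comb Q (Suc m) w k"
    "w (Suc m) = (if m = 0 then 1 else pivot_minor Q m (sigma Q m))"
proof -
  let ?bs = "map (sigma Q) [1..<Suc m]"
  have len: "length [1..<Suc m + 1] = Suc (length ?bs)" by simp
  obtain c where
    c: "\<And>k. det (select_submatrix Q [1..<Suc m + 1] (?bs @ [k]))
          = (\<Sum>i<Suc (length ?bs). c i * entry Q ([1..<Suc m + 1] ! i) k)"
    and c_last: "c (length ?bs) = det (select_submatrix Q (butlast [1..<Suc m + 1]) ?bs)"
    by (rule det_select_append_column[OF len, of Q]) blast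
  show ?thesis
  proof (rule that[of "\<lambda>i. c (i - 1)"])
    show "pivot_minor Q (Suc m) k = row_comb Q (Suc m) (\<lambda>i. c (i - 1)) k" for k
    proof -
      have "row_comb Q (Suc m) (\<lambda>i. c (i - 1)) k = (\<Sum>i<Suc m. c i * entry Q (Suc i) k)"
        unfolding row_comb_def One_nat_def sum.atLeast1_atMost_eq by simp
      also have "\<dots> = (\<Sum>i<Suc (length ?bs). c i * entry Q ([1..<Suc m + 1] ! i) k)"
        by (intro sum.cong) (auto simp del: upt_Suc)
      finally show ?thesis
        by (simp only: pivot_minor_def c)
    qed
    show "c (Suc m - 1) = (if m = 0 then 1 else pivot_minor Q m (sigma Q m))"
    proof (cases m)
      case 0
      \<comment> \<open>Without earlier pivots the corner cofactor is a 0 by 0 determinant, whose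
        value is 1.\<close>
      have "det (select_submatrix Q (butlast [1..<Suc m + 1]) ?bs) = 1"
        using 0 by (intro det_dim_zero select_submatrix_carrier) auto
      then show ?thesis using c_last 0 by simp
    next
      case (Suc l)
      have "[1..<Suc m + 1] = [1..<m + 1] @ [m + 1]" by simp
      then have "butlast [1..<Suc m + 1] = [1..<m + 1]" by (simp only: butlast_snoc)
      moreover have "?bs = map (sigma Q) [1..<m] @ [sigma Q m]" using Suc by simp
      ultimately show ?thesis using c_last Suc
        by (simp del: upt_Suc add: pivot_minor_def)
    qed
  qed
qed

lemma sigma_eq_Min_pivot_minor:
  assumes "1 \<le> m"
  shows "sigma Q m = Min {k \<in> {1..dim_col Q}. pivot_minor Q m k \<noteq> 0}"
proof (cases "m = 1")
  case True
  obtain w where "\<And>k. pivot_minor Q (Suc 0) k = row_comb Q (Suc 0) w k" "w (Suc 0) = 1"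
    by (rule pivot_minor_eq_row_comb[of Q 0]) auto
  then have "pivot_minor Q 1 k = entry Q 1 k" for k
    by (simp add: row_comb_def)
  then show ?thesis using True by (simp add: sigma.simps)
next
  case False
  then show ?thesis using assms
    by (subst sigma.simps) (simp add: pivot_minor_def)
qed

text \<open>Column \<open>sigma Q j\<close> already stands in the list, so the minor has two equal
  columns.\<close>

lemma pivot_minor_earlier_pivot:
  assumes "1 \<le> j" "j < m"
  shows "pivot_minor Q m (sigma Q j) = 0"
proof -
  let ?M = "select_submatrix Q [1..<m + 1] (map (sigma Q) [1..<m] @ [sigma Q j])"
  have carrier: "?M \<in> carrier_mat m m"
    using assms by (intro select_submatrix_carrier) auto
  have "col ?M (j - 1) = col ?M (m - 1)"
    using assms by (intro eq_vecI) (auto simp: select_submatrix_def nth_append simp del: upt_Suc)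
  then have "det ?M = 0"
    using assms by (intro det_identical_columns[OF carrier, of "j - 1" "m - 1"]) auto
  then show ?thesis by (simp add: pivot_minor_def)
qed

text \<open>Rows of an invertible matrix are independent: a vanishing combination, padded with zero
  coefficients, would be a nonzero kernel vector of the transpose.\<close>

lemma row_comb_nonzero:
  assumes Q: "Q \<in> carrier_mat n n" and det: "det Q \<noteq> 0"
    and m: "m \<in> {1..n}" and v: "v m \<noteq> 0"
  shows "\<exists>k\<in>{1..n}. row_comb Q m v k \<noteq> 0"
proof (rule ccontr)
  assume "\<not> ?thesis"
  then have zero: "row_comb Q m v k = 0" if "k \<in> {1..n}" for k using that by auto
  define u where "u = vec n (\<lambda>i. if i < m then v (Suc i) else 0)"
  have "transpose_mat Q *\<^sub>v u = 0\<^sub>v n"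
  proof (intro eq_vecI)
    fix k assume "k < dim_vec (0\<^sub>v n :: real vec)"
    then have k: "k < n" by simp
    have "(transpose_mat Q *\<^sub>v u) $ k = (\<Sum>i<n. Q $$ (i, k) * (if i < m then v (Suc i) else 0))"
      using Q k by (simp add: u_def scalar_prod_def atLeast0LessThan)
    also have "\<dots> = (\<Sum>i<m. Q $$ (i, k) * v (Suc i))"
      using m by (intro sum.mono_neutral_cong_right) auto
    also have "\<dots> = row_comb Q m v (Suc k)"
      by (simp add: row_comb_def sum.atLeast1_atMost_eq entry_def mult.commute)
    also have "\<dots> = 0" using k by (intro zero) auto
    finally show "(transpose_mat Q *\<^sub>v u) $ k = 0\<^sub>v n $ k" using k by simp
  qed (use Q in simp)
  moreover have "u \<noteq> 0\<^sub>v n"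
  proof
    assume "u = 0\<^sub>v n"
    then have "u $ (m - 1) = 0" using m by auto
    then show False using m v by (auto simp: u_def)
  qed
  moreover have "u \<in> carrier_vec n" by (simp add: u_def)
  moreover have "transpose_mat Q \<in> carrier_mat n n" using Q by simp
  ultimately have "det (transpose_mat Q) = 0"
    using det_0_iff_vec_prod_zero by blast
  then show False using det det_transpose[OF Q] by simp
qed

text \<open>The \<open>Min\<close> is taken over a nonempty set, by induction: the minor for
  \<open>Suc m\<close> is a combination of rows whose last coefficient is the previous pivot minor
  (or 1), so it cannot vanish in every column.\<close>

lemma sigma_pivot:
  assumes Q: "Q \<in> carrier_mat n n" and det: "det Q \<noteq> 0" and m: "m \<in> {1..n}"
  shows "sigma Q m \<in> {1..n}" "pivot_minor Q m (sigma Q m) \<noteq> 0"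
    "\<And>k. k \<in> {1..<sigma Q m} \<Longrightarrow> pivot_minor Q m k = 0"
proof -
  have "sigma Q m \<in> {1..n} \<and> pivot_minor Q m (sigma Q m) \<noteq> 0
      \<and> (\<forall>k\<in>{1..<sigma Q m}. pivot_minor Q m k = 0)"
    using m
  proof (induction m)
    case (Suc m)
    obtain w where w: "\<And>k. pivot_minor Q (Suc m) k = row_comb Q (Suc m) w k"
      and "w (Suc m) = (if m = 0 then 1 else pivot_minor Q m (sigma Q m))"
      by (rule pivot_minor_eq_row_comb[of Q m]) blast
    with Suc have "w (Suc m) \<noteq> 0" by auto
    with row_comb_nonzero[OF Q det Suc.prems]
    obtain k where k: "k \<in> {1..n}" "pivot_minor Q (Suc m) k \<noteq> 0"
      unfolding w by blast
    let ?S = "{k \<in> {1..n}. pivot_minor Q (Suc m) k \<noteq> 0}"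
    have sigma: "sigma Q (Suc m) = Min ?S"
      using Q by (simp add: sigma_eq_Min_pivot_minor)
    have fin: "finite ?S" by simp
    have mem: "sigma Q (Suc m) \<in> ?S"
      unfolding sigma using k by (intro Min_in fin) auto
    have "pivot_minor Q (Suc m) k = 0" if "k \<in> {1..<sigma Q (Suc m)}" for k
    proof (rule ccontr)
      assume "pivot_minor Q (Suc m) k \<noteq> 0"
      with that mem have "k \<in> ?S" by auto
      then have "sigma Q (Suc m) \<le> k" unfolding sigma by (intro Min_le fin)
      with that show False by simp
    qed
    with mem show ?case by blast
  qed simp
  then show "sigma Q m \<in> {1..n}" "pivot_minor Q m (sigma Q m) \<noteq> 0"
    "\<And>k. k \<in> {1..<sigma Q m} \<Longrightarrow> pivot_minor Q m k = 0" by auto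
qed

lemma sigma_pivot_row:
  assumes Q: "Q \<in> carrier_mat n n" and det: "det Q \<noteq> 0" and m: "m \<in> {1..n}"
  obtains w where "w m \<noteq> 0" "\<And>k. pivot_minor Q m k = row_comb Q m w k"
    "leading_column Q m w (sigma Q m)"
proof -
  obtain l where l: "m = Suc l" using m by (cases m) auto
  obtain w where w: "\<And>k. pivot_minor Q m k = row_comb Q m w k"
    and wm: "w m = (if l = 0 then 1 else pivot_minor Q l (sigma Q l))"
    unfolding l by (rule pivot_minor_eq_row_comb[of Q l]) blast
  have "w m \<noteq> 0"
  proof (cases "l = 0")
    case False
    then have "l \<in> {1..n}" using m l by auto
    from sigma_pivot(2)[OF Q det this] show ?thesis using wm False by simp
  qed (use wm in simp)
  moreover have "leading_column Q m w (sigma Q m)"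
    using sigma_pivot[OF Q det m] by (auto simp: leading_column_def w)
  ultimately show ?thesis using that w by blast
qed

text \<open>Otherwise, subtracting a multiple of the pivot row would leave a combination of the
  first \<open>m\<close> rows leading at the new pivot. That column would then be an earlier pivot,
  where the new minor is zero. The premise \<open>earlier\<close> is the induction hypothesis of the
  next lemma, kept abstract so that the argument can be reused after that induction.\<close>

lemma leading_column_eliminate:
  assumes Q: "Q \<in> carrier_mat n n" and det: "det Q \<noteq> 0" and m: "Suc m \<le> n"
    and earlier: "\<And>v p. leading_column Q m v p \<Longrightarrow> p \<in> sigma Q ` {1..m}"
    and zero: "\<And>k. k \<in> {1..sigma Q (Suc m)} \<Longrightarrow> row_comb Q (Suc m) v k = 0"
  shows "v (Suc m) = 0"
proof (rule ccontr)
  let ?s = "sigma Q (Suc m)"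
  assume nz: "v (Suc m) \<noteq> 0"
  have m': "Suc m \<in> {1..n}" using m by simp
  obtain w where w: "w (Suc m) \<noteq> 0" "leading_column Q (Suc m) w ?s"
    by (rule sigma_pivot_row[OF Q det m']) blast
  \<comment> \<open>This ratio cancels row \<open>Suc m\<close>; being nonzero, it keeps the leading
    entry of \<open>w\<close> in column \<open>?s\<close>.\<close>
  define c where "c = v (Suc m) / w (Suc m)"
  define v' where "v' = (\<lambda>i. v i - c * w i)"
  have c: "c \<noteq> 0" "v' (Suc m) = 0" using nz w by (auto simp: c_def v'_def)
  then have "row_comb Q m v' k = row_comb Q (Suc m) v k - c * row_comb Q (Suc m) w k" for k
    using row_comb_Suc[of Q m v' k] row_comb_diff_scaled[of Q "Suc m" v c w k]
    by (simp add: v'_def)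
  then have "leading_column Q m v' ?s"
    using w(2) zero c by (auto simp: leading_column_def)
  then obtain j where "j \<in> {1..m}" "?s = sigma Q j" using earlier by blast
  then show False
    using pivot_minor_earlier_pivot[of j "Suc m" Q] sigma_pivot(2)[OF Q det m'] by auto
qed

text \<open>Compare \<open>p\<close> with the newest pivot. To its left, subtracting a multiple of
  the pivot row removes row \<open>Suc m\<close> without moving the leading column; to its right,
  the elimination lemma shows that row \<open>Suc m\<close> does not occur. Both cases reduce to
  \<open>m\<close> rows.\<close>

lemma leading_column_in_sigma:
  assumes Q: "Q \<in> carrier_mat n n" and det: "det Q \<noteq> 0"
    and "m \<le> n" "leading_column Q m v p"
  shows "p \<in> sigma Q ` {1..m}"
  using assms(3,4)
proof (induction m arbitrary: v p)
  case 0
  then show ?case by (simp add: leading_column_def row_comb_def)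
next
  case (Suc m)
  let ?s = "sigma Q (Suc m)"
  have m': "Suc m \<in> {1..n}" using Suc.prems by simp
  obtain w where w: "w (Suc m) \<noteq> 0" "leading_column Q (Suc m) w ?s"
    by (rule sigma_pivot_row[OF Q det m']) blast
  consider "p = ?s" | "p < ?s" | "?s < p" by linarith
  then show ?case
  proof cases
    case 1
    then show ?thesis by auto
  next
    case 2
    define c where "c = v (Suc m) / w (Suc m)"
    define v' where "v' = (\<lambda>i. v i - c * w i)"
    have c: "v' (Suc m) = 0" using w by (auto simp: c_def v'_def)
    then have "row_comb Q m v' k = row_comb Q (Suc m) v k - c * row_comb Q (Suc m) w k" for k
      using row_comb_Suc[of Q m v' k] row_comb_diff_scaled[of Q "Suc m" v c w k]
      by (simp add: v'_def)
    then have "leading_column Q m v' p"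
      using w(2) Suc.prems(2) 2 by (auto simp: leading_column_def)
    then show ?thesis using Suc.IH[of v' p] Suc.prems(1) by auto
  next
    case 3
    have "v (Suc m) = 0"
    proof (rule leading_column_eliminate[OF Q det Suc.prems(1)])
      show "p \<in> sigma Q ` {1..m}" if "leading_column Q m v p" for v p
        using Suc.IH[OF _ that] Suc.prems(1) by simp
      show "row_comb Q (Suc m) v k = 0" if "k \<in> {1..?s}" for k
        using Suc.prems(2) 3 that by (auto simp: leading_column_def)
    qed
    then have "leading_column Q m v p"
      using Suc.prems(2) by (simp add: leading_column_def row_comb_Suc)
    then show ?thesis using Suc.IH[of v p] Suc.prems(1) by auto
  qed
qed

text \<open>
  In this form the pivots depend only on how far row \<open>m\<close> can be cleared from the left by the rows
  above it, so minors are no longer needed.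
\<close>

lemma le_sigma_iff:
  assumes Q: "Q \<in> carrier_mat n n" and det: "det Q \<noteq> 0" and m: "m \<in> {1..n}"
  shows "p \<le> sigma Q m \<longleftrightarrow> (\<exists>v. v m \<noteq> 0 \<and> (\<forall>k\<in>{1..<p}. row_comb Q m v k = 0))"
proof
  assume p: "p \<le> sigma Q m"
  obtain w where "w m \<noteq> 0" "leading_column Q m w (sigma Q m)"
    by (rule sigma_pivot_row[OF Q det m]) blast
  with p show "\<exists>v. v m \<noteq> 0 \<and> (\<forall>k\<in>{1..<p}. row_comb Q m v k = 0)"
    by (auto simp: leading_column_def)
next
  assume "\<exists>v. v m \<noteq> 0 \<and> (\<forall>k\<in>{1..<p}. row_comb Q m v k = 0)"
  then obtain v where v: "v m \<noteq> 0" "\<And>k. k \<in> {1..<p} \<Longrightarrow> row_comb Q m v k = 0" by blast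
  obtain l where l: "m = Suc l" using m by (cases m) auto
  show "p \<le> sigma Q m"
  proof (rule ccontr)
    assume less: "\<not> p \<le> sigma Q m"
    have l_le: "Suc l \<le> n" using m l by simp
    \<comment> \<open>With \<open>p\<close> beyond the pivot, \<open>v\<close> gives zero in every
      column up to and including the pivot.\<close>
    have "v (Suc l) = 0"
    proof (rule leading_column_eliminate[OF Q det l_le])
      show "q \<in> sigma Q ` {1..l}" if "leading_column Q l u q" for u q
        using leading_column_in_sigma[OF Q det _ that] l_le by simp
      show "row_comb Q (Suc l) v k = 0" if "k \<in> {1..sigma Q (Suc l)}" for k
        using v(2)[of k] less that unfolding l by simp
    qed
    then show False using v(1) l by simp
  qed
qed

section \<open>Linear scalar equations\<close>

text \<open>A Gronwall argument in both time directions: the derivative of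
  \<open>exp (c * s) * (y s)\<^sup>2\<close> is that function times \<open>c + 2 * r s\<close>, and
  a bound on \<open>r\<close> over a compact interval lets \<open>c\<close> fix the sign.\<close>

lemma linear_ode_zero:
  fixes y r :: "real \<Rightarrow> real"
  assumes deriv: "\<And>t. t \<ge> 0 \<Longrightarrow> (y has_real_derivative r t * y t) (at t within {0..})"
    and r: "continuous_on {0..} r"
    and a: "a \<ge> 0" "y a = 0" and t: "t \<ge> 0"
  shows "y t = 0"
proof -
  let ?T = "max a t"
  have "continuous_on {0..?T} (\<lambda>s. \<bar>r s\<bar>)"
    by (intro continuous_intros continuous_on_subset[OF r]) auto
  then have "\<exists>x\<in>{0..?T}. \<forall>s\<in>{0..?T}. \<bar>r s\<bar> \<le> \<bar>r x\<bar>"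
    using a by (intro continuous_attains_sup) (auto simp: le_max_iff_disj)
  then obtain C where C: "\<And>s. s \<in> {0..?T} \<Longrightarrow> \<bar>r s\<bar> \<le> C" by blast
  define z where "z c s = exp (c * s) * (y s)\<^sup>2" for c s
  have deriv_z: "(z c has_real_derivative (c + 2 * r s) * z c s) (at s within {0..})"
    if "s \<ge> 0" for c s
    unfolding z_def
    by (rule derivative_eq_intros deriv that refl | simp add: algebra_simps power2_eq_square)+
  have cont_z: "continuous_on {p..q} (z c)" if "0 \<le> p" for p q c
  proof (rule continuous_on_subset)
    show "continuous_on {0..} (z c)"
      using deriv_z by (intro DERIV_continuous_on) auto
  qed (use that in auto)
  \<comment> \<open>The monotonicity rules need two-sided derivatives, available at interior points
    only.\<close>
  have deriv_z': "(z c has_real_derivative (c + 2 * r s) * z c s) (at s)" if "s > 0" for c s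
  proof -
    have "at s within {0..} = at s"
      using that by (intro at_within_nhd[of s "{0<..}"]) auto
    then show ?thesis using deriv_z[of s c] that by simp
  qed
  have z_nonneg: "z c s \<ge> 0" for c s by (simp add: z_def)
  \<comment> \<open>Before \<open>a\<close> the choice \<open>2 * C\<close> makes \<open>z\<close>
    nondecreasing, after \<open>a\<close> the choice \<open>- 2 * C\<close> makes it nonincreasing;
    either way \<open>z c t\<close> is at most \<open>z c a = 0\<close>.\<close>
  have "z c t \<le> 0" if "c = (if t \<le> a then 2 * C else - 2 * C)" for c
  proof (cases "t \<le> a")
    case True
    have "z c t \<le> z c a"
    proof (rule DERIV_nonneg_imp_increasing_open[OF True _ cont_z[OF t]])
      fix s assume s: "t < s" "s < a"
      then have "\<bar>r s\<bar> \<le> C" using t by (intro C) auto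
      then have "(c + 2 * r s) * z c s \<ge> 0"
        using that True by (intro mult_nonneg_nonneg z_nonneg) auto
      then show "\<exists>d. (z c has_real_derivative d) (at s) \<and> 0 \<le> d"
        using deriv_z'[of s c] s t by auto
    qed
    then show ?thesis using a by (simp add: z_def)
  next
    case False
    then have "a \<le> t" by simp
    have "z c a \<ge> z c t"
    proof (rule DERIV_nonpos_imp_decreasing_open[OF \<open>a \<le> t\<close> _ cont_z[OF a(1)]])
      fix s assume s: "a < s" "s < t"
      then have "\<bar>r s\<bar> \<le> C" using a by (intro C) auto
      then have "(c + 2 * r s) * z c s \<le> 0"
        using that False by (intro mult_nonpos_nonneg z_nonneg) auto
      then show "\<exists>d. (z c has_real_derivative d) (at s) \<and> d \<le> 0"
        using deriv_z'[of s c] s a by auto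
    qed
    then show ?thesis using a by (simp add: z_def)
  qed
  then show ?thesis by (force simp: z_def mult_le_0_iff)
qed

section \<open>Conservation of the leading entries along the flow\<close>

text \<open>Entry of \<open>Q\<^sup>T * A * Q\<close> for \<open>A = diag_matrix n d\<close>, with
  indices counted from 0; \<open>Suc\<close> restores the numbering of \<open>d\<close>.\<close>

definition conj_entry :: "nat \<Rightarrow> (nat \<Rightarrow> real) \<Rightarrow> real mat \<Rightarrow> nat \<Rightarrow> nat \<Rightarrow> real" where
  "conj_entry n d Q l k = (\<Sum>x<n. d (Suc x) * Q $$ (x, l) * Q $$ (x, k))"

text \<open>Strictly lower minus strictly upper triangular part of \<open>Q\<^sup>T * A * Q\<close>:
  the matrix that the double sum in \<open>flow_field\<close> produces.\<close>

definition skew_part :: "nat \<Rightarrow> (nat \<Rightarrow> real) \<Rightarrow> real mat \<Rightarrow> nat \<Rightarrow> nat \<Rightarrow> real" where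
  "skew_part n d Q l k =
     (if k < l then conj_entry n d Q l k else 0) - (if l < k then conj_entry n d Q l k else 0)"

lemma conj_entry_commute: "conj_entry n d Q l k = conj_entry n d Q k l"
  unfolding conj_entry_def by (intro sum.cong) auto

lemma skew_part_antisym: "skew_part n d Q l k = - skew_part n d Q k l"
  using conj_entry_commute[of n d Q l k] by (auto simp: skew_part_def)

section \<open>The vector field in coordinates\<close>

lemma unit_diag_sandwich:
  assumes Q: "Q \<in> carrier_mat n n" and "r < n" "c < n"
  shows "(unit_diag n j * transpose_mat Q * diag_matrix n d * Q * unit_diag n k) $$ (r, c)
    = (if Suc r = j \<and> Suc c = k then conj_entry n d Q r c else 0)"
proof -
  have "unit_diag n j * transpose_mat Q
      = mat n n (\<lambda>(r, x). (if Suc r = j then 1 else 0) * Q $$ (x, r))"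
    unfolding unit_diag_def diag_matrix_def
    by (subst mat_diag_mult_left[of _ n n]) (use Q in \<open>auto intro!: eq_matI\<close>)
  then have "unit_diag n j * transpose_mat Q * diag_matrix n d
      = mat n n (\<lambda>(r, x). (if Suc r = j then 1 else 0) * Q $$ (x, r) * d (Suc x))"
    unfolding diag_matrix_def
    by (subst mat_diag_mult_right[of _ n n]) (auto intro!: eq_matI)
  then have "unit_diag n j * transpose_mat Q * diag_matrix n d * Q
      = mat n n (\<lambda>(r, c). (if Suc r = j then 1 else 0) * conj_entry n d Q r c)"
    using Q by (auto intro!: eq_matI sum.cong
        simp: scalar_prod_def conj_entry_def sum_distrib_left atLeast0LessThan)
  then have "unit_diag n j * transpose_mat Q * diag_matrix n d * Q * unit_diag n k
      = mat n n (\<lambda>(r, c). (if Suc r = j then 1 else 0) * conj_entry n d Q r c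
          * (if Suc c = k then 1 else 0))"
    by (subst (2) unit_diag_def, subst diag_matrix_def, subst mat_diag_mult_right[of _ n n])
      (auto intro!: eq_matI)
  then show ?thesis using assms by auto
qed

lemma unit_diag_carrier: "unit_diag n j \<in> carrier_mat n n"
  by (simp add: unit_diag_def diag_matrix_def)

lemma flow_field_entry:
  assumes Q: "Q \<in> carrier_mat n n" and "i < n" "k < n"
  shows "flow_field n (diag_matrix n d) Q $$ (i, k) = (\<Sum>l<n. Q $$ (i, l) * skew_part n d Q l k)"
proof -
  let ?A = "diag_matrix n d"
  let ?S = "\<lambda>j k. unit_diag n j * transpose_mat Q * ?A * Q * unit_diag n k"
  have carrier: "?S j k \<in> carrier_mat n n" for j k
    using unit_diag_carrier[of n j] unit_diag_carrier[of n k] by auto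
  have "(\<Sum>a = 1..n. \<Sum>b = 1..<a. (?S a b - ?S b a) $$ (r, c)) = skew_part n d Q r c"
    if "r < n" "c < n" for r c
  proof -
    let ?K = "conj_entry n d Q r c"
    have "(\<Sum>a = 1..n. \<Sum>b = 1..<a. (?S a b - ?S b a) $$ (r, c))
        = (\<Sum>a = 1..n. \<Sum>b = 1..<a. (if Suc r = a \<and> Suc c = b then ?K else 0)
            - (if Suc r = b \<and> Suc c = a then ?K else 0))"
    proof (intro sum.cong refl)
      fix a b
      have "(?S a b - ?S b a) $$ (r, c) = ?S a b $$ (r, c) - ?S b a $$ (r, c)"
        using carrier[of b a] that by (intro index_minus_mat) auto
      then show "(?S a b - ?S b a) $$ (r, c)
          = (if Suc r = a \<and> Suc c = b then ?K else 0) - (if Suc r = b \<and> Suc c = a then ?K else 0)"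
        by (simp only: unit_diag_sandwich[OF Q that])
    qed
    \<comment> \<open>Each term is nonzero for at most one index pair, and the constraint
      \<open>b < a\<close> turns into \<open>c < r\<close> for the first family and
      \<open>r < c\<close> for the second.\<close>
    also have "\<dots> = (\<Sum>a = 1..n. if a = Suc r then (if c < r then ?K else 0) else 0)
        - (\<Sum>a = 1..n. if a = Suc c then (if r < c then ?K else 0) else 0)"
      unfolding sum_subtractf
    proof (intro arg_cong2[of _ _ _ _ minus] sum.cong refl)
      fix a
      have "(\<Sum>b = 1..<a. if Suc r = a \<and> Suc c = b then ?K else 0)
          = (\<Sum>b = 1..<a. if b = Suc c then (if Suc r = a then ?K else 0) else 0)"
        by (intro sum.cong) auto
      then show "(\<Sum>b = 1..<a. if Suc r = a \<and> Suc c = b then ?K else 0)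
          = (if a = Suc r then (if c < r then ?K else 0) else 0)"
        by (auto simp: sum.delta)
      have "(\<Sum>b = 1..<a. if Suc r = b \<and> Suc c = a then ?K else 0)
          = (\<Sum>b = 1..<a. if b = Suc r then (if Suc c = a then ?K else 0) else 0)"
        by (intro sum.cong) auto
      then show "(\<Sum>b = 1..<a. if Suc r = b \<and> Suc c = a then ?K else 0)
          = (if a = Suc c then (if r < c then ?K else 0) else 0)"
        by (auto simp: sum.delta)
    qed
    also have "\<dots> = skew_part n d Q r c"
      using that by (simp add: sum.delta skew_part_def)
    finally show ?thesis .
  qed
  then show ?thesis
    using assms by (auto simp: flow_field_def scalar_prod_def atLeast0LessThan intro!: sum.cong)
qed

text \<open>
  For orthogonal \<open>Q\<close> the field is \<open>A * Q - Q * R\<close> with \<open>R\<close> upper triangular: the skew part differs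
  from \<open>Q\<^sup>T * A * Q\<close> only on and above the diagonal.
\<close>

lemma flow_field_orthogonal:
  assumes Q: "Q \<in> carrier_mat n n" and i: "i < n" and k: "k < n"
    and orth: "\<And>i j. i < n \<Longrightarrow> j < n \<Longrightarrow>
      (\<Sum>l<n. Q $$ (i, l) * Q $$ (j, l)) = (if i = j then 1 else 0)"
  shows "flow_field n (diag_matrix n d) Q $$ (i, k) = d (Suc i) * Q $$ (i, k)
    - (\<Sum>l\<le>k. Q $$ (i, l) * ((if l = k then 1 else 2) * conj_entry n d Q l k))"
proof -
  let ?R = "\<lambda>l. (if l = k then 1 else 2) * conj_entry n d Q l k"
  \<comment> \<open>With K the conjugated entry, the skew part is K below the diagonal, K - K on it
    and K - 2K above it; hence the factors 1 and 2 in \<open>?R\<close>.\<close>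
  have "flow_field n (diag_matrix n d) Q $$ (i, k)
      = (\<Sum>l<n. Q $$ (i, l) * conj_entry n d Q l k - (if l \<le> k then Q $$ (i, l) * ?R l else 0))"
    unfolding flow_field_entry[OF Q i k] by (intro sum.cong) (auto simp: skew_part_def)
  also have "\<dots> = (\<Sum>l<n. Q $$ (i, l) * conj_entry n d Q l k)
      - (\<Sum>l<n. if l \<le> k then Q $$ (i, l) * ?R l else 0)"
    by (rule sum_subtractf)
  also have "(\<Sum>l<n. if l \<le> k then Q $$ (i, l) * ?R l else 0) = (\<Sum>l\<le>k. Q $$ (i, l) * ?R l)"
    using k by (intro sum.mono_neutral_cong_right) auto
  \<comment> \<open>This is \<open>Q * Q\<^sup>T * A * Q = A * Q\<close>, by orthonormal
    rows.\<close>
  also have "(\<Sum>l<n. Q $$ (i, l) * conj_entry n d Q l k)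
      = (\<Sum>x<n. d (Suc x) * Q $$ (x, k) * (\<Sum>l<n. Q $$ (i, l) * Q $$ (x, l)))"
    unfolding conj_entry_def sum_distrib_left
    by (subst sum.swap) (intro sum.cong, auto)
  also have "\<dots> = (\<Sum>x<n. if x = i then d (Suc x) * Q $$ (x, k) else 0)"
    using i by (intro sum.cong) (auto simp: orth)
  also have "\<dots> = d (Suc i) * Q $$ (i, k)" using i by (simp add: sum.delta)
  finally show ?thesis .
qed

section \<open>Orthogonality along the flow\<close>

lemma flow_solution_carrier: "flow_solution n A Q \<Longrightarrow> t \<ge> 0 \<Longrightarrow> Q t \<in> carrier_mat n n"
  by (simp add: flow_solution_def)

lemma flow_solution_deriv:
  "flow_solution n A Q \<Longrightarrow> t \<ge> 0 \<Longrightarrow> i < n \<Longrightarrow> k < n \<Longrightarrow>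
    ((\<lambda>s. Q s $$ (i, k)) has_real_derivative flow_field n A (Q t) $$ (i, k)) (at t within {0..})"
  by (simp add: flow_solution_def)

lemma flow_solution_continuous:
  "flow_solution n A Q \<Longrightarrow> i < n \<Longrightarrow> k < n \<Longrightarrow> continuous_on {0..} (\<lambda>s. Q s $$ (i, k))"
  by (rule DERIV_continuous_on, rule flow_solution_deriv) auto

text \<open>The field is \<open>Q * W\<close> with \<open>W\<close> skew-symmetric, so the
  derivative of \<open>Q * Q\<^sup>T\<close> is
  \<open>Q * (W + W\<^sup>T) * Q\<^sup>T = 0\<close>.\<close>

lemma flow_solution_rows_orthonormal:
  assumes sol: "flow_solution n (diag_matrix n d) Q" and init: "Q 0 \<in> orthogonal_group n"
    and t: "t \<ge> 0" and ij: "i < n" "j < n"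
  shows "(\<Sum>l<n. Q t $$ (i, l) * Q t $$ (j, l)) = (if i = j then 1 else 0)"
proof -
  have Q0: "Q 0 \<in> carrier_mat n n" "transpose_mat (Q 0) * Q 0 = 1\<^sub>m n"
    using init by (auto simp: orthogonal_group_def)
  then have "Q 0 * transpose_mat (Q 0) = 1\<^sub>m n"
    by (intro mat_mult_left_right_inverse[of "transpose_mat (Q 0)"]) auto
  then have "(Q 0 * transpose_mat (Q 0)) $$ (i, j) = (1\<^sub>m n :: real mat) $$ (i, j)" by simp
  then have start: "(\<Sum>l<n. Q 0 $$ (i, l) * Q 0 $$ (j, l)) = (if i = j then 1 else 0)"
    using ij Q0(1) by (simp add: scalar_prod_def atLeast0LessThan)
  \<comment> \<open>Subtracting the initial value makes \<open>y\<close> vanish at 0, so the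
    uniqueness lemma applies with rate 0.\<close>
  define y where "y s = (\<Sum>l<n. Q s $$ (i, l) * Q s $$ (j, l)) - (if i = j then 1 else 0)" for s
  have "(y has_real_derivative 0 * y s) (at s within {0..})" if s: "s \<ge> 0" for s
  proof -
    let ?F = "flow_field n (diag_matrix n d) (Q s)"
    have "(y has_real_derivative
        (\<Sum>l<n. ?F $$ (i, l) * Q s $$ (j, l) + ?F $$ (j, l) * Q s $$ (i, l))) (at s within {0..})"
      unfolding y_def
      by (auto intro!: derivative_eq_intros flow_solution_deriv[OF sol s] ij)
    moreover have "(\<Sum>l<n. ?F $$ (i, l) * Q s $$ (j, l) + ?F $$ (j, l) * Q s $$ (i, l)) = 0"
    proof -
      let ?W = "skew_part n d (Q s)"
      have "(\<Sum>l<n. ?F $$ (j, l) * Q s $$ (i, l))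
          = (\<Sum>l<n. \<Sum>a<n. Q s $$ (j, a) * ?W a l * Q s $$ (i, l))"
        by (intro sum.cong)
          (auto simp: flow_field_entry[OF flow_solution_carrier[OF sol s]] ij sum_distrib_right)
      also have "\<dots> = (\<Sum>a<n. \<Sum>l<n. Q s $$ (j, a) * ?W a l * Q s $$ (i, l))"
        by (rule sum.swap)
      also have "\<dots> = (\<Sum>a<n. \<Sum>l<n. - (Q s $$ (i, l) * ?W l a * Q s $$ (j, a)))"
        by (intro sum.cong refl, subst skew_part_antisym) simp
      also have "\<dots> = - (\<Sum>a<n. ?F $$ (i, a) * Q s $$ (j, a))"
        unfolding sum_negf[symmetric]
        by (intro sum.cong)
          (auto simp: flow_field_entry[OF flow_solution_carrier[OF sol s]] ij sum_distrib_right sum_negf)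
      finally show ?thesis by (simp add: sum.distrib)
    qed
    ultimately show ?thesis by simp
  qed
  then have "y t = 0"
    by (rule linear_ode_zero[of y "\<lambda>_. 0" 0]) (auto simp: y_def start t)
  then show ?thesis by (simp add: y_def)
qed

lemma flow_solution_det_nonzero:
  assumes sol: "flow_solution n (diag_matrix n d) Q" and init: "Q 0 \<in> orthogonal_group n"
    and t: "t \<ge> 0"
  shows "det (Q t) \<noteq> 0"
proof -
  have Q: "Q t \<in> carrier_mat n n" by (rule flow_solution_carrier[OF sol t])
  have "Q t * transpose_mat (Q t) = 1\<^sub>m n"
    using Q flow_solution_rows_orthonormal[OF sol init t]
    by (intro eq_matI) (auto simp: scalar_prod_def atLeast0LessThan)
  then have "det (Q t) * det (transpose_mat (Q t)) = 1"
    using det_mult[of "Q t" n "transpose_mat (Q t)"] Q by simp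
  then show ?thesis by auto
qed

text \<open>
  The rows of \<open>exp (-t * A) * Q t\<close> solve \<open>y' = - y * R\<close> with \<open>R\<close> upper triangular, so once the
  entries to the left of column \<open>k\<close> vanish, column \<open>k\<close> obeys a homogeneous scalar equation.
\<close>

lemma flow_solution_leading_zeros:
  assumes sol: "flow_solution n (diag_matrix n d) Q" and init: "Q 0 \<in> orthogonal_group n"
    and m: "m \<le> n"
    and y: "\<And>k s. y k s = (\<Sum>i<m. v i * exp (- d (Suc i) * s) * Q s $$ (i, k))"
    and a: "a \<ge> 0" "\<And>k. k < p \<Longrightarrow> k < n \<Longrightarrow> y k a = 0"
    and "k < p" "k < n" "t \<ge> 0"
  shows "y k t = 0"
  using assms(7-9)
proof (induction k arbitrary: t rule: less_induct)
  case (less k)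
  let ?C = "\<lambda>s l. conj_entry n d (Q s) l k"
  let ?R = "\<lambda>s l. (if l = k then 1 else 2) * ?C s l"
  have deriv: "(y k has_real_derivative - ?C s k * y k s) (at s within {0..})" if s: "s \<ge> 0" for s
  proof -
    let ?F = "flow_field n (diag_matrix n d) (Q s)"
    let ?e = "\<lambda>i. v i * exp (- d (Suc i) * s)"
    have F: "?F $$ (i, k) = d (Suc i) * Q s $$ (i, k) - (\<Sum>l\<le>k. Q s $$ (i, l) * ?R s l)"
      if "i < m" for i
      using flow_field_orthogonal[OF flow_solution_carrier[OF sol s] _ less.prems(2)
          flow_solution_rows_orthonormal[OF sol init s], of i d] that m by simp
    \<comment> \<open>Differentiating the exponential weights contributes the term that cancels
      \<open>A * Q\<close> in the field.\<close>
    have "(y k has_real_derivative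
        (\<Sum>i<m. ?e i * (?F $$ (i, k) - d (Suc i) * Q s $$ (i, k)))) (at s within {0..})"
      unfolding y using m less.prems(2)
      by (auto intro!: derivative_eq_intros flow_solution_deriv[OF sol s] sum.cong
          simp: algebra_simps)
    also have "(\<Sum>i<m. ?e i * (?F $$ (i, k) - d (Suc i) * Q s $$ (i, k)))
        = (\<Sum>i<m. \<Sum>l\<le>k. - ?R s l * (?e i * Q s $$ (i, l)))"
      by (intro sum.cong refl) (auto simp: F sum_distrib_left sum_negf[symmetric] intro!: sum.cong)
    also have "\<dots> = (\<Sum>l\<le>k. - ?R s l * y l s)"
      unfolding y sum_distrib_left by (rule sum.swap)
    \<comment> \<open>By strong induction the columns left of \<open>k\<close> vanish at all times,
      leaving only the diagonal coefficient of R.\<close>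
    also have "\<dots> = (\<Sum>l\<le>k. if l = k then - ?C s k * y k s else 0)"
    proof (intro sum.cong refl)
      fix l assume "l \<in> {..k}"
      then show "- ?R s l * y l s = (if l = k then - ?C s k * y k s else 0)"
        using less.IH[of l s] less.prems s by (cases "l = k") auto
    qed
    also have "\<dots> = - ?C s k * y k s" by (simp add: sum.delta)
    finally show ?thesis .
  qed
  have cont: "continuous_on {0..} (\<lambda>s. - ?C s k)"
    unfolding conj_entry_def using less.prems(2)
    by (intro continuous_intros flow_solution_continuous[OF sol]) auto
  show ?case
    using linear_ode_zero[OF deriv cont a(1) a(2)[OF less.prems(1,2)] less.prems(3)] .
qed

text \<open>A combination witnessing the pivot at time \<open>a\<close> is carried to time
  \<open>b\<close> with its initial zeros. The order of \<open>a\<close> and \<open>b\<close> is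
  free, so exchanging them gives equality.\<close>

lemma sigma_le_sigma_flow_solution:
  assumes sol: "flow_solution n (diag_matrix n d) Q" and init: "Q 0 \<in> orthogonal_group n"
    and m: "m \<in> {1..n}" and a: "a \<ge> 0" and b: "b \<ge> 0"
  shows "sigma (Q a) m \<le> sigma (Q b) m"
proof -
  let ?s = "sigma (Q a) m"
  note sigma_iff =
    le_sigma_iff[OF flow_solution_carrier[OF sol] flow_solution_det_nonzero[OF sol init] m]
  have s: "?s \<in> {1..n}"
    by (rule sigma_pivot(1)[OF flow_solution_carrier[OF sol a] flow_solution_det_nonzero[OF sol init a] m])
  from sigma_iff[OF a a, of ?s] obtain v
    where v: "v m \<noteq> 0" "\<And>k. k \<in> {1..<?s} \<Longrightarrow> row_comb (Q a) m v k = 0" by auto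
  \<comment> \<open>The factor offsets the weight at time \<open>a\<close>, so that \<open>y\<close>
    starts there as the given combination; at time \<open>b\<close> the coefficients
    \<open>w\<close> are nonzero multiples of those of \<open>v\<close>.\<close>
  define v' where "v' i = v (Suc i) * exp (d (Suc i) * a)" for i
  define y where "y k t = (\<Sum>i<m. v' i * exp (- d (Suc i) * t) * Q t $$ (i, k))" for k t
  define w where "w i = v' (i - 1) * exp (- d i * b)" for i
  have ya: "y k a = row_comb (Q a) m v (Suc k)" for k
    unfolding y_def v'_def row_comb_def One_nat_def sum.atLeast1_atMost_eq
    by (intro sum.cong) (auto simp: entry_def exp_minus)
  have yb: "y k b = row_comb (Q b) m w (Suc k)" for k
    unfolding y_def w_def row_comb_def One_nat_def sum.atLeast1_atMost_eq
    by (intro sum.cong) (auto simp: entry_def)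
  have "row_comb (Q b) m w k = 0" if k: "k \<in> {1..<?s}" for k
  proof -
    \<comment> \<open>Columns of \<open>y\<close> count from 0, so the zeros in
      \<open>{1..<?s}\<close> become those below \<open>?s - 1\<close>.\<close>
    have "y (k - 1) b = 0"
    proof (rule flow_solution_leading_zeros[OF sol init _ y_def a _ _ _ b])
      show "y l a = 0" if "l < ?s - 1" for l
        unfolding ya using that by (intro v(2)) auto
    qed (use m k s in auto)
    then show ?thesis using k by (simp add: yb)
  qed
  moreover have "w m \<noteq> 0" using v(1) m by (auto simp: w_def v'_def)
  ultimately show ?thesis using sigma_iff[OF b b, of ?s] by blast
qed

theorem corollary5p1:
  fixes n :: nat and lam :: "nat \<Rightarrow> real" and Q :: "real \<Rightarrow> real mat"
  assumes n: "n \<ge> 1"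
    and lam_decreasing: "\<forall>i j. 1 \<le> i \<and> i < j \<and> j \<le> n \<longrightarrow> lam i > lam j"
    and lam_pos: "\<forall>i. 1 \<le> i \<and> i \<le> n \<longrightarrow> lam i > 0"
    and solution: "flow_solution n (diag_matrix n lam) Q"
    and init: "Q 0 \<in> orthogonal_group n"
  shows "\<forall>m\<in>{1..n}. \<forall>t>0. sigma (Q t) m = sigma (Q 0) m"
  using sigma_le_sigma_flow_solution[OF solution init] by (auto intro!: antisym)

end
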